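(* Let $\vartheta_0\in[0,1)$ and $\Delta>0$ with $\vartheta_0+\Delta\le 1$. Let $M:[0,1]\to\mathbb{R}$ be continuous and non-decreasing on $[0,1]$, equal to zero on $[0,\vartheta_0]$, and strictly increasing on $(\vartheta_0,\vartheta_0+\Delta)$. Let $(M_n)_{n\in\mathbb{N}}$ be a sequence of random functions $M_n:[0,1]\to\mathbb{R}$, and let $(t_n)_{n\in\mathbb{N}}$ be a deterministic sequence of positive numbers with $t_n\to 0$ such that $$\mathbb{P}\Big(\sup_{\vartheta\in[0,1]}|M_n(\vartheta)-M(\vartheta)|>t_n\Big)\longrightarrow 0\quad\text{for } n\to\infty .$$ Define $$\hat\vartheta_n=\int_0^1 I\{M_n(\vartheta)\le t_n\}\,d\vartheta .$$ Then $$\hat\vartheta_n=\vartheta_0+O_{\mathbb{P}}(\delta_n)\qquad\text{with } \delta_n=M^{-1}(2t_n)-\vartheta_0 .$$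
   Context: $I\{\cdot\}$ denotes the indicator function. The random functions $M_n$ are assumed measurable enough that the supremum and the integral above are random variables. $M$ restricted to $[\vartheta_0,\vartheta_0+\Delta]$ is invertible, and $M^{-1}:[0,M(\vartheta_0+\Delta)]\to[\vartheta_0,\vartheta_0+\Delta]$ denotes the (continuous) inverse of this restriction; $\delta_n$ is defined for all $n$ large enough that $2t_n\in[0,M(\vartheta_0+\Delta)]$. $Z_n=O_{\mathbb{P}}(a_n)$ means that $Z_n/a_n$ is bounded in probability (for $n$ large). *)

theory Defs
  imports "HOL-Probability.Probability"
begin

text \<open>A sequence is bounded in probability for large indices if some tail of it is
  uniformly tight; one tail serves all levels \<open>\<epsilon>\<close>.\<close>

definition bounded_in_prob_eventually :: "'a measure \<Rightarrow> (nat \<Rightarrow> 'a \<Rightarrow> real) \<Rightarrow> bool" where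
  "bounded_in_prob_eventually P X \<longleftrightarrow>
     (\<exists>N. \<forall>\<epsilon>>0. \<exists>C>0. \<forall>n\<ge>N. measure P {\<omega> \<in> space P. \<bar>X n \<omega>\<bar> > C} < \<epsilon>)"

text \<open>The first conjunct keeps the convention \<open>x / 0 = 0\<close> from making the quotient
  vacuously bounded.\<close>

definition bigO_prob :: "'a measure \<Rightarrow> (nat \<Rightarrow> 'a \<Rightarrow> real) \<Rightarrow> (nat \<Rightarrow> real) \<Rightarrow> bool" where
  "bigO_prob P Z a \<longleftrightarrow>
     (\<forall>\<^sub>F n in sequentially. a n \<noteq> 0) \<and>
     bounded_in_prob_eventually P (\<lambda>n \<omega>. Z n \<omega> / a n)"

definition theta_hat :: "(real \<Rightarrow> real) \<Rightarrow> real \<Rightarrow> real" where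
  "theta_hat f t = (LINT \<theta>:{0..1}|lebesgue. indicator {\<theta>. f \<theta> \<le> t} \<theta>)"

text \<open>\<open>inv_into\<close> is the inverse of the restriction of \<open>M\<close> to the given interval; its value
  is meaningful when \<open>2 * t\<close> lies in the image of that interval.\<close>

definition delta :: "(real \<Rightarrow> real) \<Rightarrow> real \<Rightarrow> real \<Rightarrow> real \<Rightarrow> real" where
  "delta M \<theta>\<^sub>0 \<Delta> t = inv_into {\<theta>\<^sub>0..\<theta>\<^sub>0 + \<Delta>} M (2 * t) - \<theta>\<^sub>0"

end

theory Submission
  imports Defs
begin

text \<open>On the event that the uniform error is at most \<open>t\<close>, the set \<open>{M\<^sub>n \<le> t}\<close> contains
  \<open>[0, \<theta>\<^sub>0]\<close> and is contained in \<open>{M \<le> 2 t} = [0, M\<^sup>-\<^sup>1(2 t)]\<close>, so the estimation error lies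
  between \<open>0\<close> and \<open>\<delta>\<^sub>n\<close>. The finitely many indices at which the exceptional event may still have
  probability at least \<open>\<epsilon>\<close> are absorbed into the constant, since the error never
  exceeds \<open>1\<close>.\<close>

text \<open>Even if \<open>x\<close> or \<open>y\<close> is an endpoint, two points
  \<open>u < v\<close> strictly between them lie in the open interval. The strict step is made
  there, and monotonicity carries it out to \<open>x\<close> and \<open>y\<close>.\<close>

lemma strict_mono_on_atLeastAtMost:
  fixes f :: "'a::{linorder,dense_order} \<Rightarrow> 'b::order"
  assumes mono: "mono_on {a..b} f" and strict: "strict_mono_on {a<..<b} f"
  shows "strict_mono_on {a..b} f"
proof (rule strict_mono_onI)
  fix x y assume xy: "x \<in> {a..b}" "y \<in> {a..b}" "x < y"
  obtain u where u: "x < u" "u < y" using dense[OF \<open>x < y\<close>] by blast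
  obtain v where v: "u < v" "v < y" using dense[OF \<open>u < y\<close>] by blast
  have "f x \<le> f u" by (rule mono_onD[OF mono]) (use xy u in auto)
  also have "f u < f v" by (rule strict_mono_onD[OF strict]) (use xy u v in auto)
  also have "f v \<le> f y" by (rule mono_onD[OF mono]) (use xy u v in auto)
  finally show "f x < f y" .
qed

lemma theta_hat_eq_measure:
  "theta_hat f t = measure lebesgue {\<theta>\<in>{0..1}. f \<theta> \<le> t}"
proof -
  have "theta_hat f t = (LINT \<theta>|lebesgue. indicator {\<theta>\<in>{0..1}. f \<theta> \<le> t} \<theta>)"
    unfolding theta_hat_def set_lebesgue_integral_def
    by (rule Bochner_Integration.integral_cong) (auto simp: indicator_def)
  then show ?thesis by simp
qed

lemma theta_hat_le:
  assumes "{\<theta>\<in>{0..1}. f \<theta> \<le> t} \<in> sets lebesgue" "{\<theta>\<in>{0..1}. f \<theta> \<le> t} \<subseteq> {0..x}" "0 \<le> x"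
  shows "theta_hat f t \<le> x"
proof -
  have "theta_hat f t \<le> measure lebesgue {0..x}"
    unfolding theta_hat_eq_measure
    by (rule measure_mono_fmeasurable) (use assms in auto)
  then show ?thesis using assms(3) by simp
qed

lemma theta_hat_ge:
  assumes "{\<theta>\<in>{0..1}. f \<theta> \<le> t} \<in> sets lebesgue" "{0..x} \<subseteq> {\<theta>\<in>{0..1}. f \<theta> \<le> t}" "0 \<le> x"
  shows "x \<le> theta_hat f t"
proof -
  \<comment> \<open>The larger set must have finite measure, since \<open>measure\<close> takes the
    value 0 on sets of infinite measure.\<close>
  have "{\<theta>\<in>{0..1}. f \<theta> \<le> t} \<in> lmeasurable"
    by (rule fmeasurableI2[of "{0..1}"]) (use assms in auto)
  then have "measure lebesgue {0..x} \<le> theta_hat f t"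
    unfolding theta_hat_eq_measure
    by (intro measure_mono_fmeasurable) (use assms in auto)
  then show ?thesis using assms(3) by simp
qed

lemma theta_hat_bounds:
  assumes "{\<theta>\<in>{0..1}. f \<theta> \<le> t} \<in> sets lebesgue"
  shows "0 \<le> theta_hat f t" "theta_hat f t \<le> 1"
proof -
  show "0 \<le> theta_hat f t" by (simp add: theta_hat_eq_measure)
  show "theta_hat f t \<le> 1" by (rule theta_hat_le[OF assms]) auto
qed

text \<open>The deterministic core, for one fixed path \<open>f\<close>. Positivity of
  \<open>delta\<close> is what later permits dividing by it.\<close>

lemma theta_hat_error_le_delta:
  assumes bounds: "0 \<le> \<theta>\<^sub>0" "\<Delta> > 0" "\<theta>\<^sub>0 + \<Delta> \<le> 1"
    and cont: "continuous_on {0..1} M" and mono: "mono_on {0..1} M"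
    and zero: "\<forall>\<theta>\<in>{0..\<theta>\<^sub>0}. M \<theta> = 0"
    and strict: "strict_mono_on {\<theta>\<^sub>0<..<\<theta>\<^sub>0 + \<Delta>} M"
    and t: "0 < t" "2 * t < M (\<theta>\<^sub>0 + \<Delta>)"
  shows "0 < delta M \<theta>\<^sub>0 \<Delta> t"
    and "\<lbrakk>{\<theta>\<in>{0..1}. f \<theta> \<le> t} \<in> sets lebesgue; \<And>\<theta>. \<theta> \<in> {0..1} \<Longrightarrow> \<bar>f \<theta> - M \<theta>\<bar> \<le> t\<rbrakk>
      \<Longrightarrow> \<bar>theta_hat f t - \<theta>\<^sub>0\<bar> \<le> delta M \<theta>\<^sub>0 \<Delta> t"
proof -
  define x where "x = inv_into {\<theta>\<^sub>0..\<theta>\<^sub>0 + \<Delta>} M (2 * t)"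
  have d: "delta M \<theta>\<^sub>0 \<Delta> t = x - \<theta>\<^sub>0" by (simp add: delta_def x_def)
  have sub: "{\<theta>\<^sub>0..\<theta>\<^sub>0 + \<Delta>} \<subseteq> {0..1}" using bounds by auto
  have M0: "M \<theta>\<^sub>0 = 0" using zero bounds by auto
  \<comment> \<open>Continuity puts \<open>2 * t\<close> in the image of the interval, so
    \<open>inv_into\<close> returns a genuine preimage there.\<close>
  have "\<exists>y\<ge>\<theta>\<^sub>0. y \<le> \<theta>\<^sub>0 + \<Delta> \<and> M y = 2 * t"
    by (rule IVT') (use t M0 bounds continuous_on_subset[OF cont sub] in auto)
  then have im: "2 * t \<in> M ` {\<theta>\<^sub>0..\<theta>\<^sub>0 + \<Delta>}" by force
  have x: "x \<in> {\<theta>\<^sub>0..\<theta>\<^sub>0 + \<Delta>}" "M x = 2 * t"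
    unfolding x_def using im by (rule inv_into_into, rule f_inv_into_f)
  have strict': "strict_mono_on {\<theta>\<^sub>0..\<theta>\<^sub>0 + \<Delta>} M"
    by (rule strict_mono_on_atLeastAtMost[OF mono_on_subset[OF mono sub] strict])
  have "x \<noteq> \<theta>\<^sub>0" using x M0 t by auto
  then show "0 < delta M \<theta>\<^sub>0 \<Delta> t" using x d by auto
  \<comment> \<open>Room to the right of \<open>x\<close> matters: beyond
    \<open>\<theta>\<^sub>0 + \<Delta>\<close> the function \<open>M\<close> may be constant, and
    with \<open>x\<close> at that end \<open>{M \<le> 2 t}\<close> could extend past
    \<open>x\<close>.\<close>
  have "x \<noteq> \<theta>\<^sub>0 + \<Delta>" using x t by auto
  then have xlt: "x < \<theta>\<^sub>0 + \<Delta>" using x by auto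
  have above: "2 * t < M \<theta>" if "\<theta> \<in> {0..1}" "x < \<theta>" for \<theta>
  proof -
    \<comment> \<open>Truncating \<theta> keeps the comparison with \<open>x\<close> inside the
      interval of strict increase; the rest of the way to \<theta> needs only monotonicity.\<close>
    have "M x < M (min \<theta> (\<theta>\<^sub>0 + \<Delta>))"
      by (rule strict_mono_onD[OF strict']) (use x xlt that bounds in auto)
    also have "\<dots> \<le> M \<theta>"
      by (rule mono_onD[OF mono]) (use that bounds in auto)
    finally show ?thesis using x by simp
  qed
  assume meas: "{\<theta>\<in>{0..1}. f \<theta> \<le> t} \<in> sets lebesgue"
    and close: "\<And>\<theta>. \<theta> \<in> {0..1} \<Longrightarrow> \<bar>f \<theta> - M \<theta>\<bar> \<le> t"
  \<comment> \<open>To the right of \<open>x\<close>,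
    \<open>f \<theta> \<ge> M \<theta> - t > 2 * t - t = t\<close>. This is why \<delta> is taken at
    level \<open>2 * t\<close>.\<close>
  have "\<theta> \<le> x" if "\<theta> \<in> {0..1}" "f \<theta> \<le> t" for \<theta>
    using above[of \<theta>] close[of \<theta>] that by (force simp: not_le[symmetric])
  then have "theta_hat f t \<le> x"
    by (intro theta_hat_le[OF meas]) (use x bounds in auto)
  moreover have "\<theta>\<^sub>0 \<le> theta_hat f t"
  proof (rule theta_hat_ge[OF meas])
    show "{0..\<theta>\<^sub>0} \<subseteq> {\<theta>\<in>{0..1}. f \<theta> \<le> t}"
    proof
      fix \<theta> assume th: "\<theta> \<in> {0..\<theta>\<^sub>0}"
      then have "\<theta> \<in> {0..1}" using bounds by auto
      then show "\<theta> \<in> {\<theta>\<in>{0..1}. f \<theta> \<le> t}" using close[of \<theta>] zero th by auto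
    qed
  qed (use bounds in auto)
  ultimately show "\<bar>theta_hat f t - \<theta>\<^sub>0\<bar> \<le> delta M \<theta>\<^sub>0 \<Delta> t" using d by auto
qed

text \<open>The tail in the definition is fixed before \<epsilon>, whereas the index from which
  \<open>A n\<close> has probability below \<epsilon> depends on \<epsilon>. The deterministic
  bounds \<open>B n\<close> close this gap, so that the tail can start at 0.\<close>

lemma bounded_in_prob_eventuallyI:
  assumes "prob_space P"
    and A: "\<And>n. A n \<in> sets P" "(\<lambda>n. measure P (A n)) \<longlonglongrightarrow> 0"
    and bound: "\<And>n \<omega>. \<omega> \<in> space P \<Longrightarrow> \<bar>X n \<omega>\<bar> \<le> B n"
    and good: "\<forall>\<^sub>F n in sequentially. \<forall>\<omega>\<in>space P - A n. \<bar>X n \<omega>\<bar> \<le> K"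
  shows "bounded_in_prob_eventually P X"
  unfolding bounded_in_prob_eventually_def
proof (rule exI[of _ 0], intro allI impI)
  interpret prob_space P by fact
  fix \<epsilon> :: real assume "\<epsilon> > 0"
  have "\<forall>\<^sub>F n in sequentially. measure P (A n) < \<epsilon>"
    by (rule order_tendstoD(2)[OF A(2) \<open>\<epsilon> > 0\<close>])
  with good have "\<forall>\<^sub>F n in sequentially.
      (\<forall>\<omega>\<in>space P - A n. \<bar>X n \<omega>\<bar> \<le> K) \<and> measure P (A n) < \<epsilon>"
    by (rule eventually_conj)
  then obtain m where
    m: "\<And>n \<omega>. n \<ge> m \<Longrightarrow> \<omega> \<in> space P - A n \<Longrightarrow> \<bar>X n \<omega>\<bar> \<le> K" "\<And>n. n \<ge> m \<Longrightarrow> measure P (A n) < \<epsilon>"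
    unfolding eventually_sequentially by blast
  \<comment> \<open>\<open>K\<close> serves the indices from \<open>m\<close> on, the sum dominates
    every \<open>B n\<close> with \<open>n < m\<close>, and the 1 makes \<open>C\<close>
    positive.\<close>
  define C where "C = 1 + \<bar>K\<bar> + (\<Sum>n<m. \<bar>B n\<bar>)"
  have sum_nonneg_B: "0 \<le> (\<Sum>n<m. \<bar>B n\<bar>)" by (rule sum_nonneg) auto
  have "measure P {\<omega> \<in> space P. \<bar>X n \<omega>\<bar> > C} < \<epsilon>" for n
  proof (cases "n < m")
    case True
    have "\<bar>B n\<bar> \<le> (\<Sum>n<m. \<bar>B n\<bar>)" by (rule member_le_sum) (use True in auto)
    then have "{\<omega> \<in> space P. \<bar>X n \<omega>\<bar> > C} = {}"
      using bound[of _ n] unfolding C_def by fastforce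
    then show ?thesis using \<open>\<epsilon> > 0\<close> by (simp only: measure_empty)
  next
    case False
    have "{\<omega> \<in> space P. \<bar>X n \<omega>\<bar> > C} \<subseteq> A n"
    proof
      fix \<omega> assume w: "\<omega> \<in> {\<omega> \<in> space P. \<bar>X n \<omega>\<bar> > C}"
      then have "\<not> \<bar>X n \<omega>\<bar> \<le> K" using sum_nonneg_B unfolding C_def mem_Collect_eq by linarith
      then show "\<omega> \<in> A n" using m(1)[of n \<omega>] False w by auto
    qed
    \<comment> \<open>Only the larger set \<open>A n\<close> has to be an event here: outside the
      sigma-algebra \<open>measure\<close> is 0.\<close>
    then have "measure P {\<omega> \<in> space P. \<bar>X n \<omega>\<bar> > C} \<le> measure P (A n)"
      by (rule finite_measure_mono[OF _ A(1)])
    then show ?thesis using m(2)[of n] False by simp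
  qed
  moreover have "C > 0" using sum_nonneg_B unfolding C_def by linarith
  ultimately show "\<exists>C>0. \<forall>n\<ge>0. measure P {\<omega> \<in> space P. \<bar>X n \<omega>\<bar> > C} < \<epsilon>" by blast
qed

theorem theorem2p1:
  fixes P :: "'a measure"
    and \<theta>\<^sub>0 \<Delta> :: real
    and M :: "real \<Rightarrow> real"
    and Mn :: "nat \<Rightarrow> 'a \<Rightarrow> real \<Rightarrow> real"
    and t :: "nat \<Rightarrow> real"
  assumes "prob_space P"
    and "0 \<le> \<theta>\<^sub>0" and "\<theta>\<^sub>0 < 1" and "\<Delta> > 0" and "\<theta>\<^sub>0 + \<Delta> \<le> 1"
    and "continuous_on {0..1} M"
    and "mono_on {0..1} M"
    and "\<forall>\<theta>\<in>{0..\<theta>\<^sub>0}. M \<theta> = 0"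
    and "strict_mono_on {\<theta>\<^sub>0<..<\<theta>\<^sub>0 + \<Delta>} M"
    and "\<forall>n. t n > 0"
    and "t \<longlonglongrightarrow> 0"
    and "\<forall>n. (\<lambda>\<omega>. SUP \<theta>\<in>{0..1}. ereal \<bar>Mn n \<omega> \<theta> - M \<theta>\<bar>) \<in> borel_measurable P"
    and "\<forall>n. \<forall>\<omega>\<in>space P. {\<theta>\<in>{0..1}. Mn n \<omega> \<theta> \<le> t n} \<in> sets lebesgue"
    and "\<forall>n. (\<lambda>\<omega>. theta_hat (Mn n \<omega>) (t n)) \<in> borel_measurable P"
    and "(\<lambda>n. measure P {\<omega> \<in> space P.
            (SUP \<theta>\<in>{0..1}. ereal \<bar>Mn n \<omega> \<theta> - M \<theta>\<bar>) > ereal (t n)}) \<longlonglongrightarrow> 0"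
  shows "bigO_prob P (\<lambda>n \<omega>. theta_hat (Mn n \<omega>) (t n) - \<theta>\<^sub>0) (\<lambda>n. delta M \<theta>\<^sub>0 \<Delta> (t n))"
proof -
  let ?d = "\<lambda>n. delta M \<theta>\<^sub>0 \<Delta> (t n)"
  \<comment> \<open>In \<open>ereal\<close> the supremum of an unbounded error is infinite, so such
    a path falls into \<open>A n\<close>.\<close>
  define S where "S n \<omega> = (SUP \<theta>\<in>{0..1}. ereal \<bar>Mn n \<omega> \<theta> - M \<theta>\<bar>)" for n \<omega>
  define A where "A n = {\<omega> \<in> space P. S n \<omega> > ereal (t n)}" for n
  have meas: "{\<theta>\<in>{0..1}. Mn n \<omega> \<theta> \<le> t n} \<in> sets lebesgue" if "\<omega> \<in> space P" for n \<omega>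
    using assms(13) that by blast
  have "strict_mono_on {\<theta>\<^sub>0..\<theta>\<^sub>0 + \<Delta>} M"
    by (rule strict_mono_on_atLeastAtMost[OF mono_on_subset[OF assms(7)] assms(9)])
      (use assms(2-5) in auto)
  then have "M \<theta>\<^sub>0 < M (\<theta>\<^sub>0 + \<Delta>)"
    by (rule strict_mono_onD) (use assms(4) in auto)
  \<comment> \<open>Since \<open>M \<theta>\<^sub>0 = 0\<close>, the range of \<open>M\<close> on
    the interval has positive length, and \<open>2 * t n\<close> eventually lies in its
    interior.\<close>
  then have "0 < M (\<theta>\<^sub>0 + \<Delta>) / 2" using assms(2,8) by auto
  then have "\<forall>\<^sub>F n in sequentially. t n < M (\<theta>\<^sub>0 + \<Delta>) / 2"
    by (rule order_tendstoD(2)[OF assms(11)])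
  then have large: "\<forall>\<^sub>F n in sequentially. 0 < t n \<and> 2 * t n < M (\<theta>\<^sub>0 + \<Delta>)"
    by eventually_elim (use assms(10) in auto)
  note error = theta_hat_error_le_delta[OF assms(2,4-9)]
  have pos: "\<forall>\<^sub>F n in sequentially. ?d n \<noteq> 0"
    using large by eventually_elim (metis error(1) less_irrefl)
  have "bounded_in_prob_eventually P (\<lambda>n \<omega>. (theta_hat (Mn n \<omega>) (t n) - \<theta>\<^sub>0) / ?d n)"
  \<comment> \<open>\<open>K = 1\<close> because the error is at most \<delta> off
    \<open>A n\<close>. The choice of \<open>B\<close> works for every \<open>n\<close>, even where
    \<open>inv_into\<close> is meaningless: both the estimator and \<open>\<theta>\<^sub>0\<close>
    lie in [0,1], and if \<open>?d n = 0\<close> both sides of the bound are 0.\<close>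
  proof (rule bounded_in_prob_eventuallyI[where A = A and K = 1 and B = "\<lambda>n. 1 / \<bar>?d n\<bar>",
        OF assms(1)])
    have [measurable]: "S n \<in> borel_measurable P" for n
      using assms(12) by (simp add: S_def[abs_def])
    show "A n \<in> sets P" for n
      unfolding A_def by measurable
    show "(\<lambda>n. measure P (A n)) \<longlonglongrightarrow> 0"
      using assms(15) by (simp add: A_def S_def)
    show "\<bar>(theta_hat (Mn n \<omega>) (t n) - \<theta>\<^sub>0) / ?d n\<bar> \<le> 1 / \<bar>?d n\<bar>" if "\<omega> \<in> space P" for n \<omega>
      using theta_hat_bounds[OF meas[OF that, of n]] assms(2,3)
      unfolding abs_divide by (intro divide_right_mono) auto
    show "\<forall>\<^sub>F n in sequentially. \<forall>\<omega>\<in>space P - A n. \<bar>(theta_hat (Mn n \<omega>) (t n) - \<theta>\<^sub>0) / ?d n\<bar> \<le> 1"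
      using large
    proof eventually_elim
      case (elim n)
      show ?case
      proof
        fix \<omega> assume w: "\<omega> \<in> space P - A n"
        then have "S n \<omega> \<le> ereal (t n)" by (auto simp: A_def not_less)
        then have "\<bar>Mn n \<omega> \<theta> - M \<theta>\<bar> \<le> t n" if "\<theta> \<in> {0..1}" for \<theta>
          using that by (auto simp: S_def SUP_le_iff)
        then have "\<bar>theta_hat (Mn n \<omega>) (t n) - \<theta>\<^sub>0\<bar> \<le> ?d n"
          using error(2)[of "t n" "Mn n \<omega>"] elim meas w by blast
        then show "\<bar>(theta_hat (Mn n \<omega>) (t n) - \<theta>\<^sub>0) / ?d n\<bar> \<le> 1"
          using error(1)[of "t n"] elim by (simp add: abs_divide)
      qed
    qed
  qed
  with pos show ?thesis unfolding bigO_prob_def by blast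
qed

end
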